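(* Let $G=(V,E)$ be a graph. Then $\mathcal{D}(G;x)=\mathcal{P}(G;x)$ if and only if for every non-isolated vertex $u\in V$ there exists $v\in N(u)$ such that $N[v]\subseteq N[u]$.
   Context: Graphs are finite and simple; $n=|V|$. $N(v)$ is the set of neighbors of $v$ and $N[v]=N(v)\cup\{v\}$. For $S\subseteq V$: $S$ is a dominating set if every vertex is in $S$ or adjacent to a vertex of $S$; $S$ is a power dominating set if, after coloring $S$, coloring every neighbor of a vertex of $S$, and then repeatedly applying the forcing rule (a colored vertex with exactly one uncolored neighbor colors that neighbor) until no changes occur, all vertices are colored. $\mathcal{D}(G;x)=\sum_{i=1}^n d(G;i)x^i$ and $\mathcal{P}(G;x)=\sum_{i=1}^n p(G;i)x^i$, where $d(G;i)$ and $p(G;i)$ are the numbers of dominating sets and power dominating sets of $G$ of size $i$. *)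

theory Defs
  imports "Graph_Theory.Pair_Digraph" "HOL-Computational_Algebra.Polynomial"
begin

text \<open>
  A finite simple graph is a \<open>pair_graph\<close>: a finite, loop-free, symmetric digraph without
  parallel arcs. An edge \<open>{u, v}\<close> is the pair of arcs \<open>(u, v)\<close> and \<open>(v, u)\<close>.
\<close>

definition nbhd :: "'a pair_pre_digraph \<Rightarrow> 'a \<Rightarrow> 'a set" where
  "nbhd G v = {w \<in> pverts G. (v, w) \<in> parcs G}"

definition closed_nbhd :: "'a pair_pre_digraph \<Rightarrow> 'a \<Rightarrow> 'a set" where
  "closed_nbhd G v = insert v (nbhd G v)"

definition isolated_vertex :: "'a pair_pre_digraph \<Rightarrow> 'a \<Rightarrow> bool" where
  "isolated_vertex G v \<longleftrightarrow> v \<in> pverts G \<and> nbhd G v = {}"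

definition dominating_set :: "'a pair_pre_digraph \<Rightarrow> 'a set \<Rightarrow> bool" where
  "dominating_set G S \<longleftrightarrow>
     S \<subseteq> pverts G \<and> (\<forall>v\<in>pverts G. v \<in> S \<or> (\<exists>s\<in>S. v \<in> nbhd G s))"

text \<open>
  \<open>forcing_step G C C'\<close>: one application of the forcing rule turns the set \<open>C\<close> of colored
  vertices into \<open>C'\<close>.
\<close>

inductive forcing_step :: "'a pair_pre_digraph \<Rightarrow> 'a set \<Rightarrow> 'a set \<Rightarrow> bool"
  for G :: "'a pair_pre_digraph" where
  force: "u \<in> C \<Longrightarrow> nbhd G u - C = {w} \<Longrightarrow> forcing_step G C (insert w C)"

text \<open>
  The final coloring does not depend on the order in which the forcing rule is applied, and no
  step is possible once all vertices are colored. So the exhaustive process colors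
  all vertices exactly if some sequence of steps reaches the whole vertex set.
\<close>

definition power_dominating_set :: "'a pair_pre_digraph \<Rightarrow> 'a set \<Rightarrow> bool" where
  "power_dominating_set G S \<longleftrightarrow>
     S \<subseteq> pverts G \<and> (forcing_step G)\<^sup>*\<^sup>* (S \<union> (\<Union>s\<in>S. nbhd G s)) (pverts G)"

definition num_dominating :: "'a pair_pre_digraph \<Rightarrow> nat \<Rightarrow> nat" where
  "num_dominating G i = card {S. dominating_set G S \<and> card S = i}"

definition num_power_dominating :: "'a pair_pre_digraph \<Rightarrow> nat \<Rightarrow> nat" where
  "num_power_dominating G i = card {S. power_dominating_set G S \<and> card S = i}"

definition domination_poly :: "'a pair_pre_digraph \<Rightarrow> int poly" where
  "domination_poly G = (\<Sum>i = 1..card (pverts G). monom (int (num_dominating G i)) i)"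

definition power_domination_poly :: "'a pair_pre_digraph \<Rightarrow> int poly" where
  "power_domination_poly G = (\<Sum>i = 1..card (pverts G). monom (int (num_power_dominating G i)) i)"

end

theory Submission
  imports Defs
begin

text \<open>
  Every dominating set is power dominating, so the polynomials agree iff every power dominating
  set is dominating. If the condition fails at \<open>u\<close>, then the complement of \<open>N[u]\<close> dominates
  everything except \<open>u\<close>, and any neighbor of \<open>u\<close> forces \<open>u\<close>. Conversely, if \<open>S\<close> is not
  dominating, choose an undominated \<open>w\<close> with \<open>N[w]\<close> minimal. If \<open>w\<close> is not isolated, then under
  the condition it has a neighbor \<open>v\<close> with \<open>N[v] = N[w]\<close>. Both the pair \<open>{v, w}\<close> of twins and a
  single isolated vertex are forts: no vertex outside has exactly one neighbor inside, so an
  uncolored fort stays uncolored forever.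
\<close>

definition closed_nbhd_set :: "'a pair_pre_digraph \<Rightarrow> 'a set \<Rightarrow> 'a set" where
  "closed_nbhd_set G S = (\<Union>s\<in>S. closed_nbhd G s)"

definition fort :: "'a pair_pre_digraph \<Rightarrow> 'a set \<Rightarrow> bool" where
  "fort G F \<longleftrightarrow> F \<noteq> {} \<and> F \<subseteq> pverts G \<and> (\<forall>u. u \<notin> F \<longrightarrow> card (nbhd G u \<inter> F) \<noteq> 1)"

lemma nbhd_subset_pverts: "nbhd G v \<subseteq> pverts G"
  by (auto simp: nbhd_def)

lemma closed_nbhd_subset_pverts: "v \<in> pverts G \<Longrightarrow> closed_nbhd G v \<subseteq> pverts G"
  by (simp add: closed_nbhd_def nbhd_subset_pverts)

lemma closed_nbhd_set_subset_pverts: "S \<subseteq> pverts G \<Longrightarrow> closed_nbhd_set G S \<subseteq> pverts G"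
  unfolding closed_nbhd_set_def using closed_nbhd_subset_pverts by fast

lemma closed_nbhd_set_eq_Un_nbhd: "closed_nbhd_set G S = S \<union> (\<Union>s\<in>S. nbhd G s)"
  by (auto simp: closed_nbhd_set_def closed_nbhd_def)

lemma (in pair_sym_digraph) nbhd_commute: "v \<in> nbhd G u \<longleftrightarrow> u \<in> nbhd G v"
  using arcs_symmetric wellformed' by (auto simp: nbhd_def)

lemma (in pair_sym_digraph) mem_closed_nbhd_set_iff:
  "v \<in> closed_nbhd_set G S \<longleftrightarrow> closed_nbhd G v \<inter> S \<noteq> {}"
  using nbhd_commute by (auto simp: closed_nbhd_set_def closed_nbhd_def)

lemma (in pair_loopfree_digraph) not_in_nbhd_self: "v \<notin> nbhd G v"
  using no_loops' by (auto simp: nbhd_def)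

lemma dominating_set_iff_closed_nbhd_set:
  "dominating_set G S \<longleftrightarrow> S \<subseteq> pverts G \<and> closed_nbhd_set G S = pverts G"
  by (auto simp: dominating_set_def closed_nbhd_set_eq_Un_nbhd nbhd_def)

lemma power_dominating_set_iff_closed_nbhd_set:
  "power_dominating_set G S \<longleftrightarrow>
     S \<subseteq> pverts G \<and> (forcing_step G)\<^sup>*\<^sup>* (closed_nbhd_set G S) (pverts G)"
  by (simp add: power_dominating_set_def closed_nbhd_set_eq_Un_nbhd)

lemma dominating_imp_power_dominating: "dominating_set G S \<Longrightarrow> power_dominating_set G S"
  by (simp add: dominating_set_iff_closed_nbhd_set power_dominating_set_iff_closed_nbhd_set)

lemma power_dominating_empty_imp_dominating:
  assumes "power_dominating_set G {}"
  shows "dominating_set G {}"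
proof -
  have "(forcing_step G)\<^sup>*\<^sup>* {} (pverts G)"
    using assms by (simp add: power_dominating_set_def)
  then have "pverts G = {}"
    by (cases rule: converse_rtranclpE) (auto elim: forcing_step.cases)
  then show ?thesis by (simp add: dominating_set_def)
qed

lemma forcing_steps_disjoint_fort:
  assumes "(forcing_step G)\<^sup>*\<^sup>* C C'" and "fort G F" and "C \<inter> F = {}"
  shows "C' \<inter> F = {}"
  using assms(1)
proof (induction rule: rtranclp_induct)
  case base
  show ?case by fact
next
  case (step D D')
  from \<open>forcing_step G D D'\<close> obtain u x
    where u: "u \<in> D" and x: "nbhd G u - D = {x}" and D': "D' = insert x D"
    by cases
  have "x \<notin> F"
  proof
    assume "x \<in> F"
    with x step.IH have "nbhd G u \<inter> F = {x}" by blast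
    then have "card (nbhd G u \<inter> F) = 1" by simp
    moreover have "u \<notin> F" using u step.IH by blast
    ultimately show False using \<open>fort G F\<close> unfolding fort_def by blast
  qed
  with D' step.IH show ?case by simp
qed

lemma power_dominating_meets_fort:
  assumes "power_dominating_set G S" and "fort G F"
  shows "closed_nbhd_set G S \<inter> F \<noteq> {}"
proof
  assume "closed_nbhd_set G S \<inter> F = {}"
  moreover have "(forcing_step G)\<^sup>*\<^sup>* (closed_nbhd_set G S) (pverts G)"
    using assms(1) by (simp add: power_dominating_set_iff_closed_nbhd_set)
  ultimately have "pverts G \<inter> F = {}" using assms(2) forcing_steps_disjoint_fort by metis
  with \<open>fort G F\<close> show False by (auto simp: fort_def)
qed

lemma (in pair_sym_digraph) fort_isolated_vertex:
  assumes "isolated_vertex G w"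
  shows "fort G {w}"
proof -
  have "nbhd G u \<inter> {w} = {}" for u
    using assms nbhd_commute by (auto simp: isolated_vertex_def)
  with assms show ?thesis by (simp add: fort_def isolated_vertex_def)
qed

lemma (in pair_sym_digraph) fort_closed_twins:
  assumes "v \<in> pverts G" "w \<in> pverts G" "v \<noteq> w"
    and twins: "closed_nbhd G v = closed_nbhd G w"
  shows "fort G {v, w}"
  unfolding fort_def
proof (intro conjI allI impI)
  fix u assume "u \<notin> {v, w}"
  then have "v \<in> nbhd G u \<longleftrightarrow> w \<in> nbhd G u"
    using twins nbhd_commute by (auto simp: closed_nbhd_def)
  then have "nbhd G u \<inter> {v, w} = {} \<or> nbhd G u \<inter> {v, w} = {v, w}" by blast
  with \<open>v \<noteq> w\<close> show "card (nbhd G u \<inter> {v, w}) \<noteq> 1" by auto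
qed (use assms in auto)

lemma (in pair_graph) undominated_fort_exists:
  assumes nested: "\<And>u. u \<in> pverts G \<Longrightarrow> \<not> isolated_vertex G u \<Longrightarrow>
      \<exists>v\<in>nbhd G u. closed_nbhd G v \<subseteq> closed_nbhd G u"
    and "pverts G - closed_nbhd_set G S \<noteq> {}"
  shows "\<exists>F. fort G F \<and> closed_nbhd_set G S \<inter> F = {}"
proof -
  let ?U = "pverts G - closed_nbhd_set G S"
  have "finite (closed_nbhd G ` ?U)" "closed_nbhd G ` ?U \<noteq> {}"
    using assms(2) pair_finite_verts by auto
  from finite_has_minimal[OF this] obtain w where w: "w \<in> ?U"
    and minimal: "\<forall>v\<in>?U. closed_nbhd G v \<subseteq> closed_nbhd G w \<longrightarrow> closed_nbhd G w = closed_nbhd G v"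
    by (auto simp only: bex_simps ball_simps)
  show ?thesis
  proof (cases "isolated_vertex G w")
    case True
    with w show ?thesis using fort_isolated_vertex by blast
  next
    case False
    with w obtain v where v: "v \<in> nbhd G w" and sub: "closed_nbhd G v \<subseteq> closed_nbhd G w"
      using nested by blast
    have "v \<in> ?U"
      using w v sub nbhd_subset_pverts by (fastforce simp: mem_closed_nbhd_set_iff)
    then have "closed_nbhd G v = closed_nbhd G w" using minimal sub by blast
    moreover have "v \<noteq> w" using v not_in_nbhd_self by blast
    ultimately have "fort G {v, w}" using \<open>v \<in> ?U\<close> w fort_closed_twins by simp
    with \<open>v \<in> ?U\<close> w show ?thesis by blast
  qed
qed

lemma (in pair_graph) power_dominating_imp_dominating:
  assumes "\<And>u. u \<in> pverts G \<Longrightarrow> \<not> isolated_vertex G u \<Longrightarrow>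
      \<exists>v\<in>nbhd G u. closed_nbhd G v \<subseteq> closed_nbhd G u"
    and pds: "power_dominating_set G S"
  shows "dominating_set G S"
proof (rule ccontr)
  assume "\<not> dominating_set G S"
  moreover have "S \<subseteq> pverts G" using pds by (simp add: power_dominating_set_def)
  ultimately have "closed_nbhd_set G S \<subset> pverts G"
    by (simp add: dominating_set_iff_closed_nbhd_set closed_nbhd_set_subset_pverts psubset_eq)
  then have "pverts G - closed_nbhd_set G S \<noteq> {}" by blast
  with assms(1) obtain F where "fort G F" "closed_nbhd_set G S \<inter> F = {}"
    using undominated_fort_exists by meson
  with power_dominating_meets_fort[OF pds] show False by blast
qed

lemma (in pair_sym_digraph) mem_closed_nbhd_set_complement_iff:
  assumes "v \<in> pverts G"
  shows "v \<in> closed_nbhd_set G (pverts G - closed_nbhd G u) \<longleftrightarrow>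
    \<not> closed_nbhd G v \<subseteq> closed_nbhd G u"
  using closed_nbhd_subset_pverts[OF assms] by (auto simp: mem_closed_nbhd_set_iff)

lemma (in pair_sym_digraph) closed_nbhd_set_complement:
  assumes "u \<in> pverts G"
    and "\<And>v. v \<in> nbhd G u \<Longrightarrow> \<not> closed_nbhd G v \<subseteq> closed_nbhd G u"
  shows "closed_nbhd_set G (pverts G - closed_nbhd G u) = pverts G - {u}" (is "?N = _")
proof (rule set_eqI)
  fix v
  have "?N \<subseteq> pverts G" by (simp add: closed_nbhd_set_subset_pverts)
  moreover have "closed_nbhd G v \<subseteq> closed_nbhd G u \<longleftrightarrow> v = u"
    using assms(2) by (auto simp: closed_nbhd_def)
  ultimately show "v \<in> ?N \<longleftrightarrow> v \<in> pverts G - {u}"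
    using mem_closed_nbhd_set_complement_iff by blast
qed

lemma (in pair_bidirected_digraph) power_dominating_if_one_undominated:
  assumes "S \<subseteq> pverts G" and N: "closed_nbhd_set G S = pverts G - {u}"
    and "u \<in> pverts G" and "\<not> isolated_vertex G u"
  shows "power_dominating_set G S"
proof -
  from assms obtain v where v: "v \<in> nbhd G u" by (auto simp: isolated_vertex_def)
  have "v \<in> closed_nbhd_set G S"
    using v N nbhd_subset_pverts[of G u] not_in_nbhd_self[of u] by blast
  moreover have "nbhd G v - closed_nbhd_set G S = {u}"
    using v N nbhd_subset_pverts[of G v] nbhd_commute by auto
  ultimately have "forcing_step G (closed_nbhd_set G S) (insert u (closed_nbhd_set G S))"
    by (rule force)
  moreover have "insert u (closed_nbhd_set G S) = pverts G" using N \<open>u \<in> pverts G\<close> by blast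
  ultimately show ?thesis
    using \<open>S \<subseteq> pverts G\<close> by (simp add: power_dominating_set_iff_closed_nbhd_set)
qed

lemma (in pair_bidirected_digraph) ex_power_dominating_not_dominating:
  assumes "u \<in> pverts G" and "\<not> isolated_vertex G u"
    and "\<And>v. v \<in> nbhd G u \<Longrightarrow> \<not> closed_nbhd G v \<subseteq> closed_nbhd G u"
  shows "\<exists>S. power_dominating_set G S \<and> \<not> dominating_set G S"
proof (intro exI conjI)
  let ?S = "pverts G - closed_nbhd G u"
  have N: "closed_nbhd_set G ?S = pverts G - {u}"
    using assms(1,3) by (rule closed_nbhd_set_complement)
  then show "power_dominating_set G ?S"
    using assms by (intro power_dominating_if_one_undominated) auto
  show "\<not> dominating_set G ?S"
    using N assms(1) by (auto simp: dominating_set_iff_closed_nbhd_set)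
qed

lemma sum_monom_eq_iff:
  fixes f g :: "nat \<Rightarrow> 'a::comm_monoid_add"
  assumes "finite I"
  shows "(\<Sum>i\<in>I. monom (f i) i) = (\<Sum>i\<in>I. monom (g i) i) \<longleftrightarrow> (\<forall>i\<in>I. f i = g i)"
proof -
  have "coeff (\<Sum>i\<in>I. monom (h i) i) k = (if k \<in> I then h k else 0)"
    for h :: "nat \<Rightarrow> 'a" and k
    using assms by (simp add: coeff_sum)
  then show ?thesis by (auto simp: poly_eq_iff)
qed

lemma card_fibers_eq_iff:
  assumes fin: "finite {x. Q x}" and imp: "\<And>x. P x \<Longrightarrow> Q x"
  shows "(\<forall>i\<in>I. card {x. P x \<and> f x = i} = card {x. Q x \<and> f x = i}) \<longleftrightarrow>
    (\<forall>x. Q x \<and> f x \<in> I \<longrightarrow> P x)"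
proof -
  have fiber: "card {x. P x \<and> f x = i} = card {x. Q x \<and> f x = i} \<longleftrightarrow>
      (\<forall>x. Q x \<and> f x = i \<longrightarrow> P x)" for i
  proof -
    have "finite {x. Q x \<and> f x = i}" using fin by simp
    moreover have "{x. P x \<and> f x = i} \<subseteq> {x. Q x \<and> f x = i}" using imp by blast
    ultimately have "card {x. P x \<and> f x = i} = card {x. Q x \<and> f x = i} \<longleftrightarrow>
        {x. P x \<and> f x = i} = {x. Q x \<and> f x = i}"
      by (intro iffI card_subset_eq) simp_all
    then show ?thesis using imp by blast
  qed
  show ?thesis unfolding fiber by blast
qed

lemma (in pair_fin_digraph) domination_poly_eq_power_domination_poly_iff:
  "domination_poly G = power_domination_poly G \<longleftrightarrow>
     (\<forall>S. power_dominating_set G S \<longrightarrow> dominating_set G S)"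
proof -
  let ?I = "{1..card (pverts G)}"
  have "finite {S. power_dominating_set G S}"
    by (rule finite_subset[of _ "Pow (pverts G)"])
      (auto simp: power_dominating_set_def pair_finite_verts)
  then have "domination_poly G = power_domination_poly G \<longleftrightarrow>
      (\<forall>S. power_dominating_set G S \<and> card S \<in> ?I \<longrightarrow> dominating_set G S)"
    by (simp add: domination_poly_def power_domination_poly_def sum_monom_eq_iff
        num_dominating_def num_power_dominating_def card_fibers_eq_iff
        dominating_imp_power_dominating del: atLeastAtMost_iff)
  moreover have "card S \<in> ?I" if "power_dominating_set G S" "S \<noteq> {}" for S
  proof -
    have "S \<subseteq> pverts G" using that by (simp add: power_dominating_set_def)
    moreover from this have "finite S" using finite_subset pair_finite_verts by blast
    ultimately show ?thesis
      using that pair_finite_verts by (simp add: card_mono Suc_le_eq card_gt_0_iff)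
  qed
  ultimately show ?thesis using power_dominating_empty_imp_dominating by metis
qed

theorem theorem13:
  fixes G :: "'a pair_pre_digraph"
  assumes "pair_graph G"
  shows "domination_poly G = power_domination_poly G \<longleftrightarrow>
    (\<forall>u\<in>pverts G. \<not> isolated_vertex G u \<longrightarrow>
       (\<exists>v\<in>nbhd G u. closed_nbhd G v \<subseteq> closed_nbhd G u))"
proof -
  interpret pair_graph G by fact
  show ?thesis (is "_ \<longleftrightarrow> ?nested")
    unfolding domination_poly_eq_power_domination_poly_iff
  proof
    assume "\<forall>S. power_dominating_set G S \<longrightarrow> dominating_set G S"
    then show ?nested using ex_power_dominating_not_dominating by blast
  next
    assume ?nested
    then show "\<forall>S. power_dominating_set G S \<longrightarrow> dominating_set G S"
      using power_dominating_imp_dominating by blast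
  qed
qed

end
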